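(* Let $U$ be a set and $\mathcal R$ a set of partial bijections on $U$ that is closed under composition and inverse. Then the theory of the structure $(U,\mathcal R)$ admits quantifier elimination: for every first-order formula $A$ of its language there is a quantifier-free formula $B$ of that language such that $A\leftrightarrow B$ holds in $(U,\mathcal R)$ for all values of the free variables.
   Context: A partial bijection on $U$ is a relation $R\subseteq U\times U$ which is a one-to-one correspondence between a subset of $U$ and a subset of $U$ (i.e. $R(x,y)\wedge R(x,y')\Rightarrow y=y'$ and $R(x,y)\wedge R(x',y)\Rightarrow x=x'$). For relations, $R^{-1}=\{(y,x)\mid (x,y)\in R\}$ and $R\circ S=\{(x,z)\mid\exists y.\,(x,y)\in S\wedge(y,z)\in R\}$. $\mathcal R$ is closed under composition and inverse if $R,S\in\mathcal R$ implies $R^{-1}\in\mathcal R$ and $R\circ S\in\mathcal R$. The structure $(U,\mathcal R)$ has universe $U$, a binary predicate symbol for each $R\in\mathcal R$ (interpreted as $R$), a constant symbol for each element $u\in U$ (interpreted as $u$), and equality. *)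

theory Defs
  imports Main
begin

definition partial_bijection_on :: "'a set \<Rightarrow> 'a rel \<Rightarrow> bool" where
  "partial_bijection_on U R \<longleftrightarrow> R \<subseteq> U \<times> U \<and> single_valued R \<and> single_valued (R\<inverse>)"

(* The usual composition of R after S, {(x, z). \<exists>y. (x, y) \<in> S \<and> (y, z) \<in> R}, is S O R. *)
definition closed_under_comp_inv :: "'a rel set \<Rightarrow> bool" where
  "closed_under_comp_inv \<R> \<longleftrightarrow> (\<forall>R\<in>\<R>. \<forall>S\<in>\<R>. R\<inverse> \<in> \<R> \<and> S O R \<in> \<R>)"

datatype 'c trm = Var nat | Const 'c

datatype ('c, 'p) fm =
    Bot
  | Eq "'c trm" "'c trm"
  | Pred 'p "'c trm" "'c trm"
  | Neg "('c, 'p) fm"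
  | Conj "('c, 'p) fm" "('c, 'p) fm"
  | Disj "('c, 'p) fm" "('c, 'p) fm"
  | Imp "('c, 'p) fm" "('c, 'p) fm"
  | Exists nat "('c, 'p) fm"
  | Forall nat "('c, 'p) fm"

fun consts_trm :: "'c trm \<Rightarrow> 'c set" where
  "consts_trm (Var x) = {}"
| "consts_trm (Const c) = {c}"

fun fv_trm :: "'c trm \<Rightarrow> nat set" where
  "fv_trm (Var x) = {x}"
| "fv_trm (Const c) = {}"

(* Formulas of the language with constant symbols C and binary predicate symbols P. *)
fun in_language :: "'c set \<Rightarrow> 'p set \<Rightarrow> ('c, 'p) fm \<Rightarrow> bool" where
  "in_language C P Bot \<longleftrightarrow> True"
| "in_language C P (Eq s t) \<longleftrightarrow> consts_trm s \<subseteq> C \<and> consts_trm t \<subseteq> C"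
| "in_language C P (Pred p s t) \<longleftrightarrow> p \<in> P \<and> consts_trm s \<subseteq> C \<and> consts_trm t \<subseteq> C"
| "in_language C P (Neg A) \<longleftrightarrow> in_language C P A"
| "in_language C P (Conj A B) \<longleftrightarrow> in_language C P A \<and> in_language C P B"
| "in_language C P (Disj A B) \<longleftrightarrow> in_language C P A \<and> in_language C P B"
| "in_language C P (Imp A B) \<longleftrightarrow> in_language C P A \<and> in_language C P B"
| "in_language C P (Exists x A) \<longleftrightarrow> in_language C P A"
| "in_language C P (Forall x A) \<longleftrightarrow> in_language C P A"

fun fv :: "('c, 'p) fm \<Rightarrow> nat set" where
  "fv Bot = {}"
| "fv (Eq s t) = fv_trm s \<union> fv_trm t"
| "fv (Pred p s t) = fv_trm s \<union> fv_trm t"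
| "fv (Neg A) = fv A"
| "fv (Conj A B) = fv A \<union> fv B"
| "fv (Disj A B) = fv A \<union> fv B"
| "fv (Imp A B) = fv A \<union> fv B"
| "fv (Exists x A) = fv A - {x}"
| "fv (Forall x A) = fv A - {x}"

fun quantifier_free :: "('c, 'p) fm \<Rightarrow> bool" where
  "quantifier_free Bot \<longleftrightarrow> True"
| "quantifier_free (Eq s t) \<longleftrightarrow> True"
| "quantifier_free (Pred p s t) \<longleftrightarrow> True"
| "quantifier_free (Neg A) \<longleftrightarrow> quantifier_free A"
| "quantifier_free (Conj A B) \<longleftrightarrow> quantifier_free A \<and> quantifier_free B"
| "quantifier_free (Disj A B) \<longleftrightarrow> quantifier_free A \<and> quantifier_free B"
| "quantifier_free (Imp A B) \<longleftrightarrow> quantifier_free A \<and> quantifier_free B"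
| "quantifier_free (Exists x A) \<longleftrightarrow> False"
| "quantifier_free (Forall x A) \<longleftrightarrow> False"

(* The elements of the universe and the relations themselves serve as symbols:
   the constant u denotes u and the predicate symbol R denotes R.  Hence the language
   of the structure given by U and \<R> consists of the formulas A with in_language U \<R> A. *)

fun trm_val :: "(nat \<Rightarrow> 'a) \<Rightarrow> 'a trm \<Rightarrow> 'a" where
  "trm_val e (Var x) = e x"
| "trm_val e (Const u) = u"

fun sat :: "'a set \<Rightarrow> (nat \<Rightarrow> 'a) \<Rightarrow> ('a, 'a rel) fm \<Rightarrow> bool" where
  "sat U e Bot \<longleftrightarrow> False"
| "sat U e (Eq s t) \<longleftrightarrow> trm_val e s = trm_val e t"
| "sat U e (Pred R s t) \<longleftrightarrow> (trm_val e s, trm_val e t) \<in> R"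
| "sat U e (Neg A) \<longleftrightarrow> \<not> sat U e A"
| "sat U e (Conj A B) \<longleftrightarrow> sat U e A \<and> sat U e B"
| "sat U e (Disj A B) \<longleftrightarrow> sat U e A \<or> sat U e B"
| "sat U e (Imp A B) \<longleftrightarrow> (sat U e A \<longrightarrow> sat U e B)"
| "sat U e (Exists x A) \<longleftrightarrow> (\<exists>u\<in>U. sat U (e(x := u)) A)"
| "sat U e (Forall x A) \<longleftrightarrow> (\<forall>u\<in>U. sat U (e(x := u)) A)"

end

theory Submission
  imports Defs
begin

text \<open>
  Existential quantifiers over a quantifier-free \<open>A\<close> are eliminated by splitting the witnesses for
  \<open>x\<close> into three kinds. A witness may be the value of a term \<open>t\<close> with \<open>x = t\<close> in \<open>A\<close>, or be linked to
  the value of a term \<open>t\<close> by some \<open>R(x,t)\<close> in \<open>A\<close>; as \<open>R\<close> is a partial bijection, \<open>x\<close> is then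
  determined by \<open>t\<close> and can be eliminated using compositions with \<open>R\<close>. For all other witnesses the truth
  of \<open>A\<close> depends only on the type of \<open>x\<close>, i.e. the set of \<open>S\<close> in \<open>A\<close> with \<open>S(x,x)\<close>. A type with
  finitely many realisations is handled by naming them with constants; a type with infinitely many
  always has an unlinked one, because each link excludes at most one element.
\<close>

section \<open>Quantifier-free formulas and replacement of their atoms\<close>

definition qf_formula :: "'c set \<Rightarrow> 'p set \<Rightarrow> nat set \<Rightarrow> ('c, 'p) fm \<Rightarrow> bool" where
  "qf_formula C P V A \<longleftrightarrow> in_language C P A \<and> quantifier_free A \<and> fv A \<subseteq> V"

fun atoms :: "('c, 'p) fm \<Rightarrow> ('c, 'p) fm set" where
  "atoms Bot = {}"
| "atoms (Eq s t) = {Eq s t}"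
| "atoms (Pred p s t) = {Pred p s t}"
| "atoms (Neg A) = atoms A"
| "atoms (Conj A B) = atoms A \<union> atoms B"
| "atoms (Disj A B) = atoms A \<union> atoms B"
| "atoms (Imp A B) = atoms A \<union> atoms B"
| "atoms (Exists x A) = atoms A"
| "atoms (Forall x A) = atoms A"

lemma finite_atoms: "finite (atoms A)"
  by (induction A) auto

lemma in_language_atom: "in_language C P A \<Longrightarrow> a \<in> atoms A \<Longrightarrow> in_language C P a"
  by (induction A) auto

lemma fv_atom: "quantifier_free A \<Longrightarrow> a \<in> atoms A \<Longrightarrow> fv a \<subseteq> fv A"
  by (induction A) auto

lemma atom_cases:
  assumes "a \<in> atoms A"
  obtains s t where "a = Eq s t" | p s t where "a = Pred p s t"
  using assms by (induction A) auto

text \<open>The truth of a quantifier-free formula is a Boolean combination of the truth of its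
  atoms, so translating the atoms and copying the connectives suffices. \<open>Q\<close> relates an
  assignment \<open>e\<close>, which evaluates the result, to an assignment \<open>e'\<close>, which
  evaluates \<open>A\<close>; in each use \<open>e'\<close> is \<open>e\<close> updated at
  \<open>x\<close> by an admissible witness. One formula must serve all such pairs at once.\<close>

lemma replace_atoms:
  assumes "quantifier_free A"
    and "\<And>a. a \<in> atoms A \<Longrightarrow>
      \<exists>b. qf_formula C P V b \<and> (\<forall>e e'. Q e e' \<longrightarrow> (sat U e' a \<longleftrightarrow> sat U e b))"
  shows "\<exists>B. qf_formula C P V B \<and> (\<forall>e e'. Q e e' \<longrightarrow> (sat U e' A \<longleftrightarrow> sat U e B))"
  using assms
proof (induction A)
  case Bot
  show ?case by (rule exI[of _ Bot]) (simp add: qf_formula_def)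
next
  case (Neg A)
  then obtain B where "qf_formula C P V B" "\<forall>e e'. Q e e' \<longrightarrow> (sat U e' A \<longleftrightarrow> sat U e B)"
    by auto
  then show ?case by (intro exI[of _ "Neg B"]) (simp add: qf_formula_def)
next
  case (Conj A A')
  obtain B B' where
    "qf_formula C P V B" "\<forall>e e'. Q e e' \<longrightarrow> (sat U e' A \<longleftrightarrow> sat U e B)"
    "qf_formula C P V B'" "\<forall>e e'. Q e e' \<longrightarrow> (sat U e' A' \<longleftrightarrow> sat U e B')"
    using Conj.IH(1)[OF _ Conj.prems(2)[unfolded atoms.simps, OF UnI1]]
      Conj.IH(2)[OF _ Conj.prems(2)[unfolded atoms.simps, OF UnI2]] Conj.prems(1)
    unfolding quantifier_free.simps by blast
  then show ?case by (intro exI[of _ "Conj B B'"]) (simp add: qf_formula_def)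
next
  case (Disj A A')
  obtain B B' where
    "qf_formula C P V B" "\<forall>e e'. Q e e' \<longrightarrow> (sat U e' A \<longleftrightarrow> sat U e B)"
    "qf_formula C P V B'" "\<forall>e e'. Q e e' \<longrightarrow> (sat U e' A' \<longleftrightarrow> sat U e B')"
    using Disj.IH(1)[OF _ Disj.prems(2)[unfolded atoms.simps, OF UnI1]]
      Disj.IH(2)[OF _ Disj.prems(2)[unfolded atoms.simps, OF UnI2]] Disj.prems(1)
    unfolding quantifier_free.simps by blast
  then show ?case by (intro exI[of _ "Disj B B'"]) (simp add: qf_formula_def)
next
  case (Imp A A')
  obtain B B' where
    "qf_formula C P V B" "\<forall>e e'. Q e e' \<longrightarrow> (sat U e' A \<longleftrightarrow> sat U e B)"
    "qf_formula C P V B'" "\<forall>e e'. Q e e' \<longrightarrow> (sat U e' A' \<longleftrightarrow> sat U e B')"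
    using Imp.IH(1)[OF _ Imp.prems(2)[unfolded atoms.simps, OF UnI1]]
      Imp.IH(2)[OF _ Imp.prems(2)[unfolded atoms.simps, OF UnI2]] Imp.prems(1)
    unfolding quantifier_free.simps by blast
  then show ?case by (intro exI[of _ "Imp B B'"]) (simp add: qf_formula_def)
next
  case (Eq s t)
  show ?case by (rule Eq.prems(2)) simp
next
  case (Pred p s t)
  show ?case by (rule Pred.prems(2)) simp
qed simp_all

lemma finite_disjunction:
  assumes "finite \<F>" "\<forall>F\<in>\<F>. qf_formula C P V F"
  shows "\<exists>B. qf_formula C P V B \<and> (\<forall>e. sat U e B \<longleftrightarrow> (\<exists>F\<in>\<F>. sat U e F))"
  using assms
proof (induction \<F>)
  case empty
  show ?case by (rule exI[of _ Bot]) (simp add: qf_formula_def)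
next
  case (insert F \<F>)
  then obtain B where "qf_formula C P V B" "\<forall>e. sat U e B \<longleftrightarrow> (\<exists>F\<in>\<F>. sat U e F)"
    by auto
  with insert.prems show ?case by (intro exI[of _ "Disj F B"]) (simp add: qf_formula_def)
qed

lemma trm_val_fun_upd: "t \<noteq> Var x \<Longrightarrow> trm_val (e(x := u)) t = trm_val e t"
  by (cases t) auto

lemma trm_val_in:
  assumes "consts_trm t \<subseteq> U" "\<forall>y\<in>fv_trm t. e y \<in> U"
  shows "trm_val e t \<in> U"
  using assms by (cases t) auto

section \<open>Links and types of a possible witness\<close>

definition unlinked :: "('a, 'a rel) fm \<Rightarrow> nat \<Rightarrow> (nat \<Rightarrow> 'a) \<Rightarrow> 'a \<Rightarrow> bool" where
  "unlinked A x e u \<longleftrightarrow> (\<forall>t. t \<noteq> Var x \<longrightarrow>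
     (Eq (Var x) t \<in> atoms A \<or> Eq t (Var x) \<in> atoms A \<longrightarrow> u \<noteq> trm_val e t) \<and>
     (\<forall>R. (Pred R (Var x) t \<in> atoms A \<longrightarrow> (u, trm_val e t) \<notin> R) \<and>
          (Pred R t (Var x) \<in> atoms A \<longrightarrow> (trm_val e t, u) \<notin> R)))"

text \<open>The atoms \<open>S(x,x)\<close> are the ones in \<open>x\<close> whose truth still
  varies among unlinked witnesses. Agreement with \<tau> is required only for the relations of these
  atoms, so finitely many sets \<tau> cover all elements.\<close>

definition has_type :: "('a, 'a rel) fm \<Rightarrow> nat \<Rightarrow> 'a rel set \<Rightarrow> 'a \<Rightarrow> bool" where
  "has_type A x \<tau> u \<longleftrightarrow> (\<forall>S. Pred S (Var x) (Var x) \<in> atoms A \<longrightarrow> ((u, u) \<in> S \<longleftrightarrow> S \<in> \<tau>))"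

section \<open>Eliminating the variable for each kind of witness\<close>

locale partial_bijections =
  fixes U :: "'a set" and \<R> :: "'a rel set"
  assumes bij: "\<forall>R\<in>\<R>. partial_bijection_on U R"
    and closed: "closed_under_comp_inv \<R>"
begin

lemma inv_closed: "R \<in> \<R> \<Longrightarrow> R\<inverse> \<in> \<R>"
  using closed by (auto simp: closed_under_comp_inv_def)

lemma comp_closed: "R \<in> \<R> \<Longrightarrow> S \<in> \<R> \<Longrightarrow> R O S \<in> \<R>"
  using closed by (auto simp: closed_under_comp_inv_def)

lemma in_U: "R \<in> \<R> \<Longrightarrow> (u, v) \<in> R \<Longrightarrow> u \<in> U"
  using bij by (auto simp: partial_bijection_on_def)

lemma left_unique: "R \<in> \<R> \<Longrightarrow> (u, v) \<in> R \<Longrightarrow> (u', v) \<in> R \<Longrightarrow> u = u'"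
  using bij by (auto simp: partial_bijection_on_def single_valued_def)

text \<open>Replacing \<open>x\<close> by \<open>t\<close> in every atom is sound without renaming:
  \<open>A\<close> has no quantifier that could capture a variable of \<open>t\<close>.\<close>

lemma eliminate_term:
  assumes A: "in_language U \<R> A" "quantifier_free A" "fv A - {x} \<subseteq> V"
    and t: "consts_trm t \<subseteq> U" "fv_trm t \<subseteq> V"
  shows "\<exists>B. qf_formula U \<R> V B \<and> (\<forall>e. sat U (e(x := trm_val e t)) A \<longleftrightarrow> sat U e B)"
proof -
  define subst where "subst s = (if s = Var x then t else s)" for s
  have val: "trm_val (e(x := trm_val e t)) s = trm_val e (subst s)" for e s
    by (simp add: subst_def trm_val_fun_upd)
  have lang: "consts_trm (subst s) \<subseteq> U \<and> fv_trm (subst s) \<subseteq> V"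
    if "consts_trm s \<subseteq> U" "fv_trm s \<subseteq> fv A" for s
    using that t A(3) by (cases s) (auto simp: subst_def)
  have "\<exists>B. qf_formula U \<R> V B \<and>
    (\<forall>e e'. e' = e(x := trm_val e t) \<longrightarrow> (sat U e' A \<longleftrightarrow> sat U e B))"
  proof (rule replace_atoms[OF A(2)])
    fix a assume a: "a \<in> atoms A"
    note l = in_language_atom[OF A(1) a] fv_atom[OF A(2) a]
    from a show "\<exists>b. qf_formula U \<R> V b \<and>
      (\<forall>e e'. e' = e(x := trm_val e t) \<longrightarrow> (sat U e' a \<longleftrightarrow> sat U e b))"
    proof (cases rule: atom_cases)
      case (1 s s')
      with l lang show ?thesis
        by (intro exI[of _ "Eq (subst s) (subst s')"]) (simp add: qf_formula_def val)
    next
      case (2 p s s')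
      with l lang show ?thesis
        by (intro exI[of _ "Pred p (subst s) (subst s')"]) (simp add: qf_formula_def val)
    qed
  qed
  then show ?thesis by simp
qed

text \<open>A witness \<open>u\<close> linked to the value of \<open>t\<close> is its only preimage
  under \<open>R\<close>, so atoms in \<open>x\<close> become atoms in \<open>t\<close> by composing
  with \<open>R\<close>: \<open>x = s\<close> becomes \<open>R(s,t)\<close>, while
  \<open>S(x,s)\<close>, \<open>S(s,x)\<close> and \<open>S(x,x)\<close> become
  \<open>R\<inverse> O S\<close> at \<open>(t,s)\<close>, \<open>S O R\<close> at
  \<open>(s,t)\<close> and \<open>R\<inverse> O S O R\<close> at \<open>(t,t)\<close>. Closure of
  \<open>\<R>\<close> keeps these relations in the language.\<close>

lemma eliminate_link:
  assumes A: "in_language U \<R> A" "quantifier_free A" "fv A - {x} \<subseteq> V"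
    and R: "R \<in> \<R>" and t: "consts_trm t \<subseteq> U" "fv_trm t \<subseteq> V"
  shows "\<exists>B. qf_formula U \<R> V B \<and>
    (\<forall>e. (\<exists>u. (u, trm_val e t) \<in> R \<and> sat U (e(x := u)) A) \<longleftrightarrow> sat U e B)"
proof -
  define Q where "Q e e' \<longleftrightarrow> (\<exists>u. (u, trm_val e t) \<in> R \<and> e' = e(x := u))" for e e'
  note uniq = left_unique[OF R]
  have "\<exists>B. qf_formula U \<R> V B \<and> (\<forall>e e'. Q e e' \<longrightarrow> (sat U e' A \<longleftrightarrow> sat U e B))"
  proof (rule replace_atoms[OF A(2)])
    fix a assume a: "a \<in> atoms A"
    have l: "in_language U \<R> a" "fv a \<subseteq> fv A"
      using in_language_atom[OF A(1) a] fv_atom[OF A(2) a] by auto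
    have V: "fv_trm s \<subseteq> V" if "fv_trm s \<subseteq> fv A" "s \<noteq> Var x" for s :: "'a trm"
      using that A(3) by (cases s) auto
    from a show "\<exists>b. qf_formula U \<R> V b \<and> (\<forall>e e'. Q e e' \<longrightarrow> (sat U e' a \<longleftrightarrow> sat U e b))"
    proof (cases rule: atom_cases)
      case (1 s s')
      define b where "b =
        (if s = Var x then if s' = Var x then Neg Bot else Pred R s' t
         else if s' = Var x then Pred R s t else Eq s s')"
      have "qf_formula U \<R> V b"
        using l 1 V[of s] V[of s'] t R by (auto simp: b_def qf_formula_def)
      moreover have "sat U e' a \<longleftrightarrow> sat U e b" if "Q e e'" for e e'
        using that 1 uniq by (auto simp: b_def Q_def trm_val_fun_upd)
      ultimately show ?thesis by blast
    next
      case (2 S s s')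
      define b where "b =
        (if s = Var x then
           if s' = Var x then Pred (R\<inverse> O S O R) t t else Pred (R\<inverse> O S) t s'
         else if s' = Var x then Pred (S O R) s t else Pred S s s')"
      have "qf_formula U \<R> V b"
        using l 2 V[of s] V[of s'] t R
        by (auto simp: b_def qf_formula_def inv_closed comp_closed)
      moreover have "sat U e' a \<longleftrightarrow> sat U e b" if Q: "Q e e'" for e e'
      proof -
        obtain u where u: "(u, trm_val e t) \<in> R" "e' = e(x := u)" using Q by (auto simp: Q_def)
        \<comment> \<open>This forces every intermediate point that a composition passes through on
          its way to or from \<open>t\<close> to be \<open>u\<close> itself.\<close>
        have "(v, trm_val e t) \<in> R \<longleftrightarrow> v = u" for v using u uniq by blast
        then show ?thesis
          using u(2) 2 by (auto simp: b_def trm_val_fun_upd relcomp_unfold)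
      qed
      ultimately show ?thesis by blast
    qed
  qed
  then obtain B where B: "qf_formula U \<R> V B" "\<And>e e'. Q e e' \<Longrightarrow> sat U e' A \<longleftrightarrow> sat U e B"
    by blast
  \<comment> \<open>\<open>B\<close> is meaningful only if a linked element exists. The added
    conjunct, going back along \<open>R\<close> from \<open>t\<close> and forward again, states
    exactly that the value of \<open>t\<close> has a preimage.\<close>
  have "qf_formula U \<R> V (Conj (Pred (R\<inverse> O R) t t) B)"
    using B(1) t R by (simp add: qf_formula_def inv_closed comp_closed)
  moreover have "(\<exists>u. (u, trm_val e t) \<in> R \<and> sat U (e(x := u)) A) \<longleftrightarrow>
      sat U e (Conj (Pred (R\<inverse> O R) t t) B)" for e
    using B(2) by (auto simp: Q_def)
  ultimately show ?thesis by blast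
qed

text \<open>For such a witness every atom joining \<open>x\<close> to another term is false,
  \<open>x = x\<close> is true, and \<open>S(x,x)\<close> is decided by \<tau>. All atoms in
  \<open>x\<close> thus become constants, and a single \<open>B\<close>, chosen before
  \<open>e\<close> and \<open>u\<close>, serves all these witnesses.\<close>

lemma eliminate_unlinked:
  assumes A: "in_language U \<R> A" "quantifier_free A"
  shows "\<exists>B. qf_formula U \<R> (fv A - {x}) B \<and>
    (\<forall>e u. unlinked A x e u \<longrightarrow> has_type A x \<tau> u \<longrightarrow> (sat U (e(x := u)) A \<longleftrightarrow> sat U e B))"
proof -
  define Q where
    "Q e e' \<longleftrightarrow> (\<exists>u. unlinked A x e u \<and> has_type A x \<tau> u \<and> e' = e(x := u))" for e e'
  have "\<exists>B. qf_formula U \<R> (fv A - {x}) B \<and> (\<forall>e e'. Q e e' \<longrightarrow> (sat U e' A \<longleftrightarrow> sat U e B))"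
  proof (rule replace_atoms[OF A(2)])
    fix a assume a: "a \<in> atoms A"
    have l: "in_language U \<R> a" "fv a \<subseteq> fv A"
      using in_language_atom[OF A(1) a] fv_atom[OF A(2) a] by auto
    have V: "fv_trm s \<subseteq> fv A - {x}" if "fv_trm s \<subseteq> fv A" "s \<noteq> Var x" for s :: "'a trm"
      using that by (cases s) auto
    from a show "\<exists>b. qf_formula U \<R> (fv A - {x}) b \<and>
      (\<forall>e e'. Q e e' \<longrightarrow> (sat U e' a \<longleftrightarrow> sat U e b))"
    proof (cases rule: atom_cases)
      case (1 s s')
      define b :: "('a, 'a rel) fm" where "b =
        (if s = Var x \<and> s' = Var x then Neg Bot
         else if s = Var x \<or> s' = Var x then Bot else Eq s s')"
      have "qf_formula U \<R> (fv A - {x}) b"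
        using l 1 V[of s] V[of s'] by (auto simp: b_def qf_formula_def)
      moreover have "sat U e' a \<longleftrightarrow> sat U e b" if Q: "Q e e'" for e e'
      proof -
        obtain u where u: "unlinked A x e u" "e' = e(x := u)" using Q by (auto simp: Q_def)
        have "u \<noteq> trm_val e s'" if "s = Var x" "s' \<noteq> Var x"
          using u(1) a that unfolding unlinked_def 1 by blast
        moreover have "u \<noteq> trm_val e s" if "s' = Var x" "s \<noteq> Var x"
          using u(1) a that unfolding unlinked_def 1 by blast
        ultimately show ?thesis using u(2) 1 by (auto simp: b_def trm_val_fun_upd)
      qed
      ultimately show ?thesis by blast
    next
      case (2 S s s')
      define b :: "('a, 'a rel) fm" where "b =
        (if s = Var x \<and> s' = Var x then if S \<in> \<tau> then Neg Bot else Bot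
         else if s = Var x \<or> s' = Var x then Bot else Pred S s s')"
      have "qf_formula U \<R> (fv A - {x}) b"
        using l 2 V[of s] V[of s'] by (auto simp: b_def qf_formula_def)
      moreover have "sat U e' a \<longleftrightarrow> sat U e b" if Q: "Q e e'" for e e'
      proof -
        obtain u where u: "unlinked A x e u" "has_type A x \<tau> u" "e' = e(x := u)"
          using Q by (auto simp: Q_def)
        have "(u, trm_val e s') \<notin> S" if "s = Var x" "s' \<noteq> Var x"
          using u(1) a that unfolding unlinked_def 2 by blast
        moreover have "(trm_val e s, u) \<notin> S" if "s' = Var x" "s \<noteq> Var x"
          using u(1) a that unfolding unlinked_def 2 by blast
        moreover have "(u, u) \<in> S \<longleftrightarrow> S \<in> \<tau>" if "s = Var x" "s' = Var x"
          using u(2) a that unfolding has_type_def 2 by blast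
        ultimately show ?thesis using u(3) 2 by (auto simp: b_def trm_val_fun_upd)
      qed
      ultimately show ?thesis by blast
    qed
  qed
  then show ?thesis unfolding Q_def by blast
qed

section \<open>Eliminating a single existential quantifier\<close>

lemma eliminate_exists:
  assumes A: "in_language U \<R> A" "quantifier_free A"
  shows "\<exists>B. qf_formula U \<R> (fv A - {x}) B \<and>
    (\<forall>e. (\<forall>y\<in>fv A - {x}. e y \<in> U) \<longrightarrow> ((\<exists>u\<in>U. sat U (e(x := u)) A) \<longleftrightarrow> sat U e B))"
proof -
  define V where "V = fv A - {x}"
  \<comment> \<open>An atom \<open>S(t,x)\<close> enters as the pair
    \<open>(S\<inverse>, t)\<close>, so that all links have \<open>x\<close> on the left and
    \<open>eliminate_link\<close> applies to each.\<close>
  define L where "L =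
    {(R, t). t \<noteq> Var x \<and> (Pred R (Var x) t \<in> atoms A \<or> Pred (R\<inverse>) t (Var x) \<in> atoms A)}"
  define T where "T = {S. Pred S (Var x) (Var x) \<in> atoms A}"
  \<comment> \<open>The realisations of a type do not depend on the assignment. Hence those of a
    type with finitely many can be listed once and for all as constants in \<open>K\<close>, next to
    the terms equated with \<open>x\<close>; \<open>I\<close> keeps the remaining types.\<close>
  define D where "D \<tau> = {u\<in>U. \<forall>S\<in>T. (u, u) \<in> S \<longleftrightarrow> S \<in> \<tau>}" for \<tau>
  define E where "E = {t. t \<noteq> Var x \<and> (Eq (Var x) t \<in> atoms A \<or> Eq t (Var x) \<in> atoms A)}"
  define K where "K = E \<union> Const ` \<Union>(D ` {\<tau>\<in>Pow T. finite (D \<tau>)})"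
  define I where "I = {\<tau>. \<tau> \<subseteq> T \<and> infinite (D \<tau>)}"

  \<comment> \<open>Finiteness of \<open>L\<close>, \<open>T\<close> and \<open>E\<close> follows
    from crude bounds: every atom contributes at most two entries, whether or not it mentions
    \<open>x\<close>.\<close>
  have "L \<subseteq> (\<Union>a\<in>atoms A. case a of Pred R s t \<Rightarrow> {(R, t), (R\<inverse>, s)} | _ \<Rightarrow> {})"
    by (force simp: L_def)
  moreover have "finite \<dots>"
    by (intro finite_UN_I finite_atoms) (auto split: fm.split)
  ultimately have fin_L: "finite L" by (rule finite_subset)
  have "T \<subseteq> (\<Union>a\<in>atoms A. case a of Pred R s t \<Rightarrow> {R} | _ \<Rightarrow> {})"
    by (force simp: T_def)
  moreover have "finite \<dots>"
    by (intro finite_UN_I finite_atoms) (auto split: fm.split)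
  ultimately have fin_T: "finite T" by (rule finite_subset)
  have "E \<subseteq> (\<Union>a\<in>atoms A. case a of Eq s t \<Rightarrow> {s, t} | _ \<Rightarrow> {})"
    by (force simp: E_def)
  moreover have "finite \<dots>"
    by (intro finite_UN_I finite_atoms) (auto split: fm.split)
  ultimately have fin_E: "finite E" by (rule finite_subset)
  have fin_K: "finite K"
    unfolding K_def using fin_E fin_T by auto
  have fin_I: "finite I"
    using fin_T by (auto simp: I_def)

  have L_ok: "R \<in> \<R> \<and> consts_trm t \<subseteq> U \<and> fv_trm t \<subseteq> V" if Rt: "(R, t) \<in> L" for R t
  proof -
    have ne: "t \<noteq> Var x" using Rt by (simp add: L_def)
    have "R \<in> \<R> \<and> consts_trm t \<subseteq> U \<and> fv_trm t \<subseteq> fv A"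
      using Rt in_language_atom[OF A(1)] fv_atom[OF A(2)] inv_closed[of "R\<inverse>"]
      by (fastforce simp: L_def)
    with ne show ?thesis by (cases t) (auto simp: V_def)
  qed
  have K_ok: "consts_trm t \<subseteq> U \<and> fv_trm t \<subseteq> V" if t: "t \<in> K" for t
  proof (cases "t \<in> E")
    case True
    then have ne: "t \<noteq> Var x" by (simp add: E_def)
    have "consts_trm t \<subseteq> U \<and> fv_trm t \<subseteq> fv A"
      using True in_language_atom[OF A(1)] fv_atom[OF A(2)] by (fastforce simp: E_def)
    with ne show ?thesis by (cases t) (auto simp: V_def)
  next
    case False
    with t show ?thesis by (auto simp: K_def D_def)
  qed

  have "\<forall>p\<in>L. \<exists>B. qf_formula U \<R> V B \<and>
    (\<forall>e. (\<exists>u. (u, trm_val e (snd p)) \<in> fst p \<and> sat U (e(x := u)) A) \<longleftrightarrow> sat U e B)"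
    using eliminate_link[OF A] L_ok by (auto simp: V_def)
  then obtain FL where FL: "\<forall>p\<in>L. qf_formula U \<R> V (FL p) \<and>
    (\<forall>e. (\<exists>u. (u, trm_val e (snd p)) \<in> fst p \<and> sat U (e(x := u)) A) \<longleftrightarrow> sat U e (FL p))"
    by (rule bchoice[THEN exE])
  have "\<forall>t\<in>K. \<exists>B. qf_formula U \<R> V B \<and>
    (\<forall>e. sat U (e(x := trm_val e t)) A \<longleftrightarrow> sat U e B)"
    using eliminate_term[OF A] K_ok by (auto simp: V_def)
  then obtain FK where FK: "\<forall>t\<in>K. qf_formula U \<R> V (FK t) \<and>
    (\<forall>e. sat U (e(x := trm_val e t)) A \<longleftrightarrow> sat U e (FK t))"
    by (rule bchoice[THEN exE])
  \<comment> \<open>This set varies with \<open>e\<close>, whereas the formulas chosen for the types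
    below must not.\<close>
  define linked where "linked e =
    trm_val e ` E \<union> (\<Union>(R, t)\<in>L. {u. (u, trm_val e t) \<in> R})" for e
  have "\<exists>B. qf_formula U \<R> V B \<and>
    (\<forall>e. \<forall>u\<in>D \<tau> - linked e. sat U (e(x := u)) A \<longleftrightarrow> sat U e B)" for \<tau>
  proof -
    obtain B where B: "qf_formula U \<R> V B" and B_iff: "\<And>e u. unlinked A x e u \<Longrightarrow>
        has_type A x \<tau> u \<Longrightarrow> sat U (e(x := u)) A \<longleftrightarrow> sat U e B"
      using eliminate_unlinked[OF A, of x \<tau>] unfolding V_def by blast
    have "sat U (e(x := u)) A \<longleftrightarrow> sat U e B" if u: "u \<in> D \<tau> - linked e" for e u
    proof (rule B_iff)
      show "unlinked A x e u"
        unfolding unlinked_def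
      proof (intro allI impI conjI)
        fix t :: "'a trm" assume t: "t \<noteq> Var x"
        have lk: "(u, trm_val e t) \<notin> R" if "(R, t) \<in> L" for R
          using u that by (auto simp: linked_def)
        \<comment> \<open>An atom with \<open>x\<close> on the right is recorded in \<open>L\<close>
          through the converse relation.\<close>
        show "(trm_val e t, u) \<notin> R" if "Pred R t (Var x) \<in> atoms A" for R
          using lk[of "R\<inverse>"] that t by (simp add: L_def)
        show "(u, trm_val e t) \<notin> R" if "Pred R (Var x) t \<in> atoms A" for R
          using lk[of R] that t by (simp add: L_def)
        show "u \<noteq> trm_val e t" if "Eq (Var x) t \<in> atoms A \<or> Eq t (Var x) \<in> atoms A"
          using u that t by (auto simp: linked_def E_def)
      qed
      show "has_type A x \<tau> u"
        using u by (simp add: has_type_def D_def T_def)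
    qed
    with B show ?thesis by blast
  qed
  then obtain FI where FI: "\<And>\<tau>. qf_formula U \<R> V (FI \<tau>)"
    "\<And>\<tau> e u. u \<in> D \<tau> - linked e \<Longrightarrow> sat U (e(x := u)) A \<longleftrightarrow> sat U e (FI \<tau>)"
    by metis

  \<comment> \<open>One disjunct for each link, each term naming a witness and each type with
    infinitely many realisations. The last kind needs no clause asserting that an unlinked witness
    exists, since one always does.\<close>
  define \<F> where "\<F> = FL ` L \<union> FK ` K \<union> FI ` I"
  have "finite \<F>"
    using fin_L fin_K fin_I by (simp add: \<F>_def)
  moreover have "\<forall>F\<in>\<F>. qf_formula U \<R> V F"
    unfolding \<F>_def using FL FK FI(1) by (simp add: ball_Un)
  ultimately obtain B where B: "qf_formula U \<R> V B"
    and B_iff: "\<forall>e. sat U e B \<longleftrightarrow> (\<exists>F\<in>\<F>. sat U e F)"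
    using finite_disjunction[of \<F> U \<R> V U] by blast
  have "(\<exists>u\<in>U. sat U (e(x := u)) A) \<longleftrightarrow> sat U e B" if e: "\<forall>y\<in>V. e y \<in> U" for e
  proof -
    have B_sat: "sat U e B \<longleftrightarrow>
        (\<exists>p\<in>L. sat U e (FL p)) \<or> (\<exists>t\<in>K. sat U e (FK t)) \<or> (\<exists>\<tau>\<in>I. sat U e (FI \<tau>))"
      using B_iff by (simp add: \<F>_def bex_Un)
    show ?thesis
    proof
      assume "\<exists>u\<in>U. sat U (e(x := u)) A"
      then obtain u where u: "u \<in> U" "sat U (e(x := u)) A" by blast
      define \<tau> where "\<tau> = {S\<in>T. (u, u) \<in> S}"
      have uD: "u \<in> D \<tau>" "\<tau> \<subseteq> T" using u(1) by (auto simp: D_def \<tau>_def)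
      \<comment> \<open>If the type of \<open>u\<close> has only finitely many realisations,
        \<open>u\<close> is named by a constant. Otherwise it is unlinked or caught by an equation
        or a link.\<close>
      consider "u \<in> trm_val e ` E" | R t where "(R, t) \<in> L" "(u, trm_val e t) \<in> R"
        | "finite (D \<tau>)" | "u \<notin> linked e" "infinite (D \<tau>)"
        by (auto simp: linked_def)
      then show "sat U e B"
      proof cases
        case 1
        then obtain t where "t \<in> K" "u = trm_val e t" by (auto simp: K_def)
        with u(2) FK B_sat show ?thesis by blast
      next
        case 2
        with u(2) FL have "sat U e (FL (R, t))" by force
        with 2 B_sat show ?thesis by blast
      next
        case 3
        with uD have "Const u \<in> K" by (auto simp: K_def)
        moreover from this u(2) FK have "sat U e (FK (Const u))" by force
        ultimately show ?thesis using B_sat by blast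
      next
        case 4
        with uD have "\<tau> \<in> I" by (simp add: I_def)
        moreover have "sat U e (FI \<tau>)" using FI(2) uD 4 u(2) by blast
        ultimately show ?thesis using B_sat by blast
      qed
    next
      assume "sat U e B"
      then consider p where "p \<in> L" "sat U e (FL p)" | t where "t \<in> K" "sat U e (FK t)"
        | \<tau> where "\<tau> \<in> I" "sat U e (FI \<tau>)"
        using B_sat by blast
      then show "\<exists>u\<in>U. sat U (e(x := u)) A"
      proof cases
        case 1
        then obtain u where "(u, trm_val e (snd p)) \<in> fst p" "sat U (e(x := u)) A"
          using FL by blast
        \<comment> \<open>\<open>eliminate_link\<close> does not restrict its witness to
          \<open>U\<close>; membership comes from \<open>R\<close> being a relation on
          \<open>U\<close>.\<close>
        moreover have "fst p \<in> \<R>" using L_ok[of "fst p" "snd p"] 1 by simp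
        ultimately show ?thesis using in_U by blast
      next
        case 2
        then have "trm_val e t \<in> U" using K_ok e by (intro trm_val_in) auto
        with 2 FK show ?thesis by blast
      next
        case 3
        \<comment> \<open>Injectivity of \<open>R\<close> leaves at most one element per link. So
          \<open>linked e\<close> is finite and cannot exhaust the infinite set
          \<open>D \<tau>\<close>.\<close>
        have "finite {u. (u, v) \<in> R}" if "R \<in> \<R>" for R v
        proof (cases "\<exists>u. (u, v) \<in> R")
          case True
          then obtain u where "(u, v) \<in> R" by blast
          then have "{u. (u, v) \<in> R} \<subseteq> {u}" using left_unique[OF that] by blast
          then show ?thesis by (rule finite_subset) simp
        qed simp
        then have "finite (linked e)"
          using fin_E fin_L L_ok by (auto simp: linked_def)
        then have "infinite (D \<tau> - linked e)" using 3(1) by (simp add: I_def)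
        then obtain u where "u \<in> D \<tau> - linked e" using infinite_imp_nonempty by blast
        moreover from this have "u \<in> U" by (simp add: D_def)
        ultimately show ?thesis using FI(2) 3(2) by blast
      qed
    qed
  qed
  with B show ?thesis unfolding V_def by blast
qed

section \<open>Quantifier elimination for arbitrary formulas\<close>

lemma quantifier_elimination:
  assumes "in_language U \<R> A"
  shows "\<exists>B. qf_formula U \<R> (fv A) B \<and>
    (\<forall>e. (\<forall>y\<in>fv A. e y \<in> U) \<longrightarrow> (sat U e A \<longleftrightarrow> sat U e B))"
  using assms
proof (induction A)
  case (Neg A)
  then obtain B where "qf_formula U \<R> (fv A) B"
    "\<forall>e. (\<forall>y\<in>fv A. e y \<in> U) \<longrightarrow> (sat U e A \<longleftrightarrow> sat U e B)" by auto
  then show ?case by (intro exI[of _ "Neg B"]) (simp add: qf_formula_def)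
next
  case (Conj A A')
  then obtain B B' where
    "qf_formula U \<R> (fv A) B" "\<forall>e. (\<forall>y\<in>fv A. e y \<in> U) \<longrightarrow> (sat U e A \<longleftrightarrow> sat U e B)"
    "qf_formula U \<R> (fv A') B'" "\<forall>e. (\<forall>y\<in>fv A'. e y \<in> U) \<longrightarrow> (sat U e A' \<longleftrightarrow> sat U e B')"
    by auto
  then show ?case by (intro exI[of _ "Conj B B'"]) (auto simp: qf_formula_def)
next
  case (Disj A A')
  then obtain B B' where
    "qf_formula U \<R> (fv A) B" "\<forall>e. (\<forall>y\<in>fv A. e y \<in> U) \<longrightarrow> (sat U e A \<longleftrightarrow> sat U e B)"
    "qf_formula U \<R> (fv A') B'" "\<forall>e. (\<forall>y\<in>fv A'. e y \<in> U) \<longrightarrow> (sat U e A' \<longleftrightarrow> sat U e B')"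
    by auto
  then show ?case by (intro exI[of _ "Disj B B'"]) (auto simp: qf_formula_def)
next
  case (Imp A A')
  then obtain B B' where
    "qf_formula U \<R> (fv A) B" "\<forall>e. (\<forall>y\<in>fv A. e y \<in> U) \<longrightarrow> (sat U e A \<longleftrightarrow> sat U e B)"
    "qf_formula U \<R> (fv A') B'" "\<forall>e. (\<forall>y\<in>fv A'. e y \<in> U) \<longrightarrow> (sat U e A' \<longleftrightarrow> sat U e B')"
    by auto
  then show ?case by (intro exI[of _ "Imp B B'"]) (auto simp: qf_formula_def)
next
  case (Exists x A)
  then obtain B where B: "qf_formula U \<R> (fv A) B"
    "\<And>e. (\<forall>y\<in>fv A. e y \<in> U) \<Longrightarrow> sat U e A \<longleftrightarrow> sat U e B" by auto
  \<comment> \<open>The single-quantifier step is applied to the quantifier-free equivalent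
    \<open>B\<close>. As its free variables lie among those of \<open>A\<close>, the condition that
    \<open>e\<close> takes values in \<open>U\<close> carries over to it.\<close>
  obtain B' where B': "qf_formula U \<R> (fv B - {x}) B'"
    "\<And>e. (\<forall>y\<in>fv B - {x}. e y \<in> U) \<Longrightarrow> (\<exists>u\<in>U. sat U (e(x := u)) B) \<longleftrightarrow> sat U e B'"
    using eliminate_exists[of B x] B(1) by (auto simp: qf_formula_def)
  have "sat U e (Exists x A) \<longleftrightarrow> sat U e B'" if "\<forall>y\<in>fv A - {x}. e y \<in> U" for e
  proof -
    \<comment> \<open>The induction hypothesis applies at the updated assignment because the
      quantifier ranges over \<open>U\<close>.\<close>
    have "sat U (e(x := u)) A \<longleftrightarrow> sat U (e(x := u)) B" if "u \<in> U" for u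
      using that \<open>\<forall>y\<in>fv A - {x}. e y \<in> U\<close> by (intro B(2)) auto
    moreover have "\<forall>y\<in>fv B - {x}. e y \<in> U" using that B(1) by (auto simp: qf_formula_def)
    ultimately show ?thesis using B'(2) by auto
  qed
  moreover have "qf_formula U \<R> (fv A - {x}) B'"
    using B(1) B'(1) by (auto simp: qf_formula_def)
  ultimately show ?case by auto
next
  case (Forall x A)
  then obtain B where B: "qf_formula U \<R> (fv A) B"
    "\<And>e. (\<forall>y\<in>fv A. e y \<in> U) \<Longrightarrow> sat U e A \<longleftrightarrow> sat U e B" by auto
  \<comment> \<open>Eliminating the quantifier from \<open>Exists x (Neg B)\<close> gives a
    \<open>B'\<close> that expresses the existence of a counterexample; the formula sought is
    \<open>Neg B'\<close>.\<close>
  obtain B' where B': "qf_formula U \<R> (fv B - {x}) B'"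
    "\<And>e. (\<forall>y\<in>fv B - {x}. e y \<in> U) \<Longrightarrow> (\<exists>u\<in>U. \<not> sat U (e(x := u)) B) \<longleftrightarrow> sat U e B'"
    using eliminate_exists[of "Neg B" x] B(1) by (auto simp: qf_formula_def)
  have "sat U e (Forall x A) \<longleftrightarrow> sat U e (Neg B')" if "\<forall>y\<in>fv A - {x}. e y \<in> U" for e
  proof -
    have "sat U (e(x := u)) A \<longleftrightarrow> sat U (e(x := u)) B" if "u \<in> U" for u
      using that \<open>\<forall>y\<in>fv A - {x}. e y \<in> U\<close> by (intro B(2)) auto
    moreover have "\<forall>y\<in>fv B - {x}. e y \<in> U" using that B(1) by (auto simp: qf_formula_def)
    ultimately show ?thesis using B'(2) by auto
  qed
  moreover have "qf_formula U \<R> (fv A - {x}) (Neg B')"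
    using B(1) B'(1) by (auto simp: qf_formula_def)
  ultimately show ?case by (metis fv.simps(9))
next
  case Bot
  then show ?case by (intro exI[of _ Bot]) (simp add: qf_formula_def)
next
  case (Eq s t)
  then show ?case by (intro exI[of _ "Eq s t"]) (simp add: qf_formula_def)
next
  case (Pred R s t)
  then show ?case by (intro exI[of _ "Pred R s t"]) (simp add: qf_formula_def)
qed

end

theorem theorem7p3:
  fixes U :: "'a set" and \<R> :: "'a rel set"
  assumes "\<forall>R\<in>\<R>. partial_bijection_on U R"
    and "closed_under_comp_inv \<R>"
  shows "\<forall>A. in_language U \<R> A \<longrightarrow>
    (\<exists>B. in_language U \<R> B \<and> quantifier_free B \<and>
      (\<forall>e. (\<forall>x \<in> fv A \<union> fv B. e x \<in> U) \<longrightarrow> (sat U e A \<longleftrightarrow> sat U e B)))"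
proof -
  interpret partial_bijections U \<R>
    using assms by unfold_locales
  show ?thesis
    using quantifier_elimination unfolding qf_formula_def by blast
qed

end
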